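(* Let $n$ and $r$ be positive integers, let $t_1,\ldots,t_r$ be positive integers and put $\tau=t_1t_2\cdots t_r$. Suppose $\mathcal{C}$ is a family (set) of $r$-multichains in $B(n)$ such that $\mathcal{C}_k$ is $t_k$-chain free for each $k\in\{1,\ldots,r\}$. Then $$\sum_{a_1+\cdots+a_{r+1}=n}\frac{|\mathcal{C}_{a_1,\ldots,a_r}|}{\binom{n}{a_1,\ldots,a_{r+1}}}\le\tau,$$ where the sum is over all $(r+1)$-tuples of non-negative integers $(a_1,\ldots,a_{r+1})$ with $a_1+\cdots+a_{r+1}=n$. Consequently, $$|\mathcal{C}|\le m_1+\cdots+m_\tau,$$ where $m_1,\ldots,m_\tau$ are the $\tau$ largest multinomial coefficients $\binom{n}{a_1,\ldots,a_{r+1}}$ for non-negative integers $a_1,\ldots,a_{r+1}$ with $a_1+\cdots+a_{r+1}=n$.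
   Context: $[n]=\{1,\ldots,n\}$ and $B(n)$ is the lattice of all subsets of $[n]$ ordered by inclusion. A chain of length $t$ in $B(n)$ is a collection of $t+1$ (distinct) subsets of $[n]$ that are pairwise comparable under inclusion. A family $\mathcal{A}\subseteq B(n)$ is $t$-chain free if it contains no chain of length $t$ (so $1$-chain free means antichain). An $r$-multichain in $B(n)$ is an $r$-tuple $(C_1,\ldots,C_r)$ of elements of $B(n)$ with $C_1\subseteq C_2\subseteq\cdots\subseteq C_r$. For a family $\mathcal{C}$ of $r$-multichains, $\mathcal{C}_k=\{C_k\mid (C_1,\ldots,C_k,\ldots,C_r)\in\mathcal{C}\}$ for $k\in\{1,\ldots,r\}$, and for non-negative integers $a_1,\ldots,a_r$ with $a_1+\cdots+a_r\le n$, $\mathcal{C}_{a_1,\ldots,a_r}=\{(C_1,\ldots,C_r)\in\mathcal{C}\mid |C_i|=a_1+\cdots+a_i \text{ for all } i=1,\ldots,r\}$. $\binom{n}{a_1,\ldots,a_{r+1}}=\frac{n!}{a_1!\cdots a_{r+1}!}$. The "$\tau$ largest" coefficients are taken from the list of values indexed by all tuples $(a_1,\ldots,a_{r+1})$, i.e. counted with multiplicity (different tuples giving the same value count separately); if $\tau$ exceeds the number of such tuples, the missing $m_i$ are set to $0$. *)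

theory Defs
  imports Complex_Main "HOL-Library.Multiset"
begin

text \<open>
  A multichain is a list of subsets of \<open>{1..n}\<close>. Lists are indexed from 0, so the mathematical
  component \<open>C\<^sub>k\<close> is \<open>C ! (k - 1)\<close> for \<open>1 \<le> k \<le> r\<close>.
\<close>

definition multichains :: "nat \<Rightarrow> nat \<Rightarrow> nat set list set" where
  "multichains n r = {C. length C = r \<and> set C \<subseteq> Pow {1..n} \<and> sorted_wrt (\<subseteq>) C}"

definition component :: "nat set list set \<Rightarrow> nat \<Rightarrow> nat set set" where
  "component \<C> k = (\<lambda>C. C ! (k - 1)) ` \<C>"

text \<open>A chain of length \<open>t\<close> consists of \<open>t + 1\<close> distinct sets.\<close>

definition chain_free :: "nat \<Rightarrow> 'a set set \<Rightarrow> bool" where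
  "chain_free t \<A> \<longleftrightarrow> \<not> (\<exists>K \<subseteq> \<A>. card K = t + 1 \<and> chain\<^sub>\<subseteq> K)"

text \<open>The list \<open>a\<close> is \<open>(a\<^sub>1, \<dots>, a\<^sub>r)\<close>, without the last entry \<open>a\<^bsub>r+1\<^esub>\<close>.\<close>

definition layer :: "nat set list set \<Rightarrow> nat list \<Rightarrow> nat set list set" where
  "layer \<C> a = {C \<in> \<C>. \<forall>i \<in> {1..length a}. card (C ! (i - 1)) = sum_list (take i a)}"

definition compositions :: "nat \<Rightarrow> nat \<Rightarrow> nat list set" where
  "compositions n s = {a. length a = s \<and> sum_list a = n}"

definition multinomial :: "nat \<Rightarrow> nat list \<Rightarrow> real" where
  "multinomial n a = fact n / prod_list (map fact a)"

text \<open>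
  All multinomial coefficients with \<open>s\<close> lower entries, in decreasing order, each value
  listed once for every tuple attaining it.
\<close>

definition multinomials_desc :: "nat \<Rightarrow> nat \<Rightarrow> real list" where
  "multinomials_desc n s =
     rev (sorted_list_of_multiset (image_mset (multinomial n) (mset_set (compositions n s))))"

definition largest_multinomial :: "nat \<Rightarrow> nat \<Rightarrow> nat \<Rightarrow> real" where
  "largest_multinomial n s i =
     (if 1 \<le> i \<and> i \<le> length (multinomials_desc n s)
      then multinomials_desc n s ! (i - 1) else 0)"

text \<open>
  \<^const>\<open>card\<close>, \<^const>\<open>sum\<close> and \<^const>\<open>mset_set\<close> take a default value on infinite sets;
  the following two facts exclude that case.
\<close>

lemma finite_multichains: "finite (multichains n r)"
proof (rule finite_subset)
  show "multichains n r \<subseteq> {C. set C \<subseteq> Pow {1..n} \<and> length C = r}"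
    by (auto simp: multichains_def)
  show "finite {C. set C \<subseteq> Pow {1..n} \<and> length C = r}"
    by (rule finite_lists_length_eq) simp
qed

lemma finite_compositions: "finite (compositions n s)"
proof (rule finite_subset)
  show "compositions n s \<subseteq> {a. set a \<subseteq> {..n} \<and> length a = s}"
    by (auto simp: compositions_def intro: member_le_sum_list)
  show "finite {a. set a \<subseteq> {..n} \<and> length a = s}"
    by (rule finite_lists_length_eq) simp
qed

end

theory Submission
  imports Defs "HOL-Combinatorics.Multiset_Permutations" "HOL-Library.FuncSet"
begin

text \<open>
  Order \<open>{1..n}\<close> uniformly at random. A fixed multichain with step sizes \<open>a\<close> consists of
  initial segments of that order with probability \<open>1 / multinomial n a\<close>, so the left-hand side of
  the first inequality is the expected number of members of \<open>\<C>\<close> made of initial segments. The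
  initial segments of one order form a chain, hence at most \<open>t k\<close> of them lie in the \<open>k\<close>-th
  component, and the number in question never exceeds the product of the \<open>t k\<close>. The same count for
  a single layer shows that each summand is at most 1, and a sum of the multinomial coefficients
  with weights in \<open>[0, 1]\<close> of total at most \<open>\<tau>\<close> is at most the sum of the \<open>\<tau>\<close> largest ones.
\<close>

section \<open>Step sizes of multichains and initial segments of orders\<close>

text \<open>The extra last entry of \<open>a\<close> is what remains of \<open>card S\<close> after
  the last set of \<open>C\<close>. The ground set \<open>S\<close> is arbitrary because the
  inductions below remove the last set and continue inside it.\<close>

definition step_sizes :: "'a set \<Rightarrow> 'a set list \<Rightarrow> nat list \<Rightarrow> bool" where
  "step_sizes S C a \<longleftrightarrow> length a = Suc (length C) \<and> sum_list a = card S \<and>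
     (\<forall>i < length C. card (C ! i) = sum_list (take (Suc i) a))"

text \<open>Testing the prefix of length \<open>card X\<close> makes \<open>X\<close> the only
  initial segment of its size.\<close>

definition initial_segments :: "'a list \<Rightarrow> 'a set list \<Rightarrow> bool" where
  "initial_segments xs C \<longleftrightarrow> (\<forall>X \<in> set C. set (take (card X) xs) = X)"

lemma multinomial_pos: "multinomial n a > 0"
proof -
  have "prod_list (map fact a) > (0 :: real)" by (induction a) auto
  then show ?thesis by (simp add: multinomial_def)
qed

lemma step_sizes_Nil: "step_sizes S [] a \<longleftrightarrow> a = [card S]"
  by (auto simp: step_sizes_def length_Suc_conv)

text \<open>Removing the last set \<open>X\<close> makes it the ground set for the rest: the steps
  up to \<open>X\<close> add up to \<open>card X\<close>, and only the gap from \<open>X\<close> to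
  \<open>S\<close> is split off.\<close>

lemma step_sizes_snoc:
  assumes "finite S" "X \<subseteq> S"
  shows "step_sizes S (C @ [X]) a \<longleftrightarrow> (\<exists>b. step_sizes X C b \<and> a = b @ [card S - card X])"
proof
  assume *: "step_sizes S (C @ [X]) a"
  then obtain b c where a: "a = b @ [c]" by (cases a rule: rev_cases) (auto simp: step_sizes_def)
  have len: "length b = Suc (length C)" using * a by (simp add: step_sizes_def)
  \<comment> \<open>The index \<open>length C\<close> is included: there the set is \<open>X\<close>
    and the prefix is all of \<open>b\<close>.\<close>
  have part: "card ((C @ [X]) ! i) = sum_list (take (Suc i) b)" if "i \<le> length C" for i
    using * that len by (auto simp: step_sizes_def a)
  have "card X = sum_list b" using part[of "length C"] len by simp
  moreover have "card (C ! i) = sum_list (take (Suc i) b)" if "i < length C" for i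
    using part[of i] that by (simp add: nth_append)
  moreover have "sum_list b + c = card S" using * by (simp add: step_sizes_def a)
  ultimately show "\<exists>b. step_sizes X C b \<and> a = b @ [card S - card X]"
    using len by (intro exI[of _ b]) (auto simp: a step_sizes_def)
next
  \<comment> \<open>Makes the subtraction \<open>card S - card X\<close> on naturals exact.\<close>
  have le: "card X \<le> card S" using assms by (simp add: card_mono)
  assume "\<exists>b. step_sizes X C b \<and> a = b @ [card S - card X]"
  then show "step_sizes S (C @ [X]) a"
    using le by (auto simp: step_sizes_def nth_append less_Suc_eq)
qed

lemma ex1_step_sizes:
  assumes "finite S" "sorted_wrt (\<subseteq>) C" "set C \<subseteq> Pow S"
  shows "\<exists>!a. step_sizes S C a"
  using assms
proof (induction C arbitrary: S rule: rev_induct)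
  case Nil
  then show ?case by (simp add: step_sizes_Nil)
next
  case (snoc X C)
  have "finite X" using snoc.prems by (auto intro: finite_subset)
  then have "\<exists>!b. step_sizes X C b"
    using snoc.prems by (intro snoc.IH) (auto simp: sorted_wrt_append)
  then show ?case using snoc.prems by (auto simp: step_sizes_snoc)
qed

text \<open>Such an order lists the blocks between consecutive sets of \<open>C\<close> one after
  another, each block in any internal order, so the factorials of the block sizes multiply. The
  induction cuts the order where the last set ends.\<close>

lemma card_initial_segments:
  assumes "finite S" "sorted_wrt (\<subseteq>) C" "set C \<subseteq> Pow S" "step_sizes S C a"
  shows "card {xs \<in> permutations_of_set S. initial_segments xs C} = prod_list (map fact a)"
  using assms
proof (induction C arbitrary: S a rule: rev_induct)
  case Nil
  then show ?case by (simp add: step_sizes_Nil initial_segments_def)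
next
  case (snoc X C)
  have X: "finite X" "X \<subseteq> S" using snoc.prems by (auto intro: finite_subset)
  have CX: "\<forall>Y \<in> set C. Y \<subseteq> X" and C: "sorted_wrt (\<subseteq>) C"
    using snoc.prems by (auto simp: sorted_wrt_append)
  obtain b where b: "step_sizes X C b" "a = b @ [card S - card X]"
    using snoc.prems X by (auto simp: step_sizes_snoc)
  \<comment> \<open>The sets in \<open>C\<close> lie inside \<open>X\<close>, so their prefixes end
    within \<open>ys\<close>, and \<open>X\<close> is the prefix \<open>ys\<close> itself;
    \<open>zs\<close> stays free.\<close>
  have segs_append: "initial_segments (ys @ zs) (C @ [X]) \<longleftrightarrow> initial_segments ys C"
    if "ys \<in> permutations_of_set X" for ys zs
  proof -
    have "length ys = card X" "set ys = X"
      using that by (auto simp: permutations_of_set_def distinct_card)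
    moreover have "card Y \<le> card X" if "Y \<in> set C" for Y
      using CX X that by (auto intro: card_mono)
    ultimately show ?thesis by (auto simp: initial_segments_def)
  qed
  let ?P = "{ys \<in> permutations_of_set X. initial_segments ys C}"
  let ?Q = "permutations_of_set (S - X)"
  have "{xs \<in> permutations_of_set S. initial_segments xs (C @ [X])}
          = (\<lambda>(ys, zs). ys @ zs) ` (?P \<times> ?Q)"
  proof (intro equalityI subsetI)
    fix xs assume xs: "xs \<in> {xs \<in> permutations_of_set S. initial_segments xs (C @ [X])}"
    define ys zs where "ys = take (card X) xs" and "zs = drop (card X) xs"
    have split: "xs = ys @ zs" by (simp add: ys_def zs_def)
    have "set ys = X" using xs by (simp add: initial_segments_def ys_def)
    moreover have "distinct (ys @ zs)" "set (ys @ zs) = S"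
      using xs by (auto simp: permutations_of_set_def split)
    ultimately have "ys \<in> permutations_of_set X" "zs \<in> ?Q"
      by (auto simp: permutations_of_set_def)
    then show "xs \<in> (\<lambda>(ys, zs). ys @ zs) ` (?P \<times> ?Q)"
      using xs segs_append by (auto simp: split)
  next
    fix xs assume "xs \<in> (\<lambda>(ys, zs). ys @ zs) ` (?P \<times> ?Q)"
    then obtain ys zs where "xs = ys @ zs" "ys \<in> ?P" "zs \<in> ?Q" by auto
    then show "xs \<in> {xs \<in> permutations_of_set S. initial_segments xs (C @ [X])}"
      using X segs_append by (auto simp: permutations_of_set_def)
  qed
  moreover have "inj_on (\<lambda>(ys, zs). ys @ zs) (?P \<times> ?Q)"
  proof (rule inj_onI, clarify)
    fix ys zs ys' zs'
    assume "ys @ zs = ys' @ zs'" "ys \<in> permutations_of_set X" "ys' \<in> permutations_of_set X"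
    moreover from this have "length ys = length ys'"
      by (metis distinct_card permutations_of_setD)
    ultimately show "ys = ys' \<and> zs = zs'" by simp
  qed
  ultimately have "card {xs \<in> permutations_of_set S. initial_segments xs (C @ [X])}
      = card ?P * card ?Q"
    by (simp add: card_image card_cartesian_product)
  also have "card ?P = prod_list (map fact b)"
    using snoc.IH[OF X(1) C _ b(1)] CX by auto
  also have "card ?Q = fact (card S - card X)"
    using X snoc.prems by (simp add: card_Diff_subset)
  finally show ?case by (simp add: b)
qed

section \<open>Layers and double counting over orders\<close>

text \<open>Dropping the last entry loses nothing: in a composition of \<open>n\<close> the first
  \<open>r\<close> entries determine it.\<close>

lemma layer_eq_step_sizes:
  assumes "\<C> \<subseteq> multichains n r" "a \<in> compositions n (r + 1)"
  shows "layer \<C> (butlast a) = {C \<in> \<C>. step_sizes {1..n} C a}"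
proof -
  have len: "length a = Suc r" "sum_list a = n"
    using assms(2) by (auto simp: compositions_def)
  have tk: "take (Suc i) (butlast a) = take (Suc i) a" if "i < r" for i
    using that len by (simp add: take_butlast)
  \<comment> \<open>Shifts from the 1-based index of \<open>layer\<close> to the 0-based index of
    \<open>step_sizes\<close>.\<close>
  have "(\<forall>i \<in> {1..r}. P i) \<longleftrightarrow> (\<forall>i<r. P (Suc i))" for P
    using Suc_le_eq by (auto simp: Ball_def) (metis Suc_le_D Suc_le_eq One_nat_def)
  then show ?thesis
    using len assms(1) by (auto simp: layer_def step_sizes_def multichains_def tk)
qed

text \<open>Each multichain has exactly one vector of step sizes, so it is met in exactly one
  layer.\<close>

lemma layers_partition:
  assumes "\<C> \<subseteq> multichains n r"
  shows "(\<Sum>a \<in> compositions n (r + 1). \<Sum>C \<in> layer \<C> (butlast a). f C) = sum f \<C>"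
proof -
  have ex1: "\<exists>!a. step_sizes {1..n} C a" if "C \<in> \<C>" for C
    using that assms by (intro ex1_step_sizes) (auto simp: multichains_def)
  have comp: "a \<in> compositions n (r + 1)" if "C \<in> \<C>" "step_sizes {1..n} C a" for C a
    using that assms by (auto simp: multichains_def step_sizes_def compositions_def)
  have fin: "finite \<C>" using assms finite_multichains by (rule finite_subset)
  have "(\<Sum>a \<in> compositions n (r + 1). \<Sum>C \<in> layer \<C> (butlast a). f C)
      = (\<Sum>a \<in> compositions n (r + 1). \<Sum>C \<in> {C \<in> \<C>. step_sizes {1..n} C a}. f C)"
    using assms by (intro sum.cong) (simp_all add: layer_eq_step_sizes)
  also have "\<dots> = sum f (\<Union>a \<in> compositions n (r + 1). {C \<in> \<C>. step_sizes {1..n} C a})"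
  proof (intro sum.UNION_disjoint[symmetric] finite_compositions ballI impI)
    show "finite {C \<in> \<C>. step_sizes {1..n} C a}" for a using fin by simp
    show "{C \<in> \<C>. step_sizes {1..n} C a} \<inter> {C \<in> \<C>. step_sizes {1..n} C b} = {}"
      if "a \<noteq> b" for a b using ex1 that by blast
  qed
  also have "(\<Union>a \<in> compositions n (r + 1). {C \<in> \<C>. step_sizes {1..n} C a}) = \<C>"
  proof (intro equalityI subsetI)
    fix C assume C: "C \<in> \<C>"
    then obtain a where "step_sizes {1..n} C a" using ex1 by blast
    then show "C \<in> (\<Union>a \<in> compositions n (r + 1). {C \<in> \<C>. step_sizes {1..n} C a})"
      using C comp by blast
  qed auto
  finally show ?thesis .
qed

text \<open>Double counting of pairs of a multichain and an order in which its sets are initial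
  segments. The bound \<open>N\<close> is left open to serve both the whole family and a single
  layer.\<close>

lemma sum_layers_le:
  assumes \<C>: "\<C> \<subseteq> multichains n r"
    and le: "\<And>xs. card {C \<in> \<C>. initial_segments xs C} \<le> N"
  shows "(\<Sum>a \<in> compositions n (r + 1). real (card (layer \<C> (butlast a))) / multinomial n a) \<le> N"
proof -
  let ?Perms = "permutations_of_set {1..n}"
  let ?w = "\<lambda>C. card {xs \<in> ?Perms. initial_segments xs C}"
  have fin: "finite \<C>" using \<C> finite_multichains by (rule finite_subset)
  \<comment> \<open>Splits the summand into one term per multichain, namely its share of all
    \<open>fact n\<close> orders.\<close>
  have "real (card (layer \<C> (butlast a))) / multinomial n a
      = (\<Sum>C \<in> layer \<C> (butlast a). ?w C / fact n)" if a: "a \<in> compositions n (r + 1)" for a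
  proof -
    have "?w C = prod_list (map fact a)" if "C \<in> layer \<C> (butlast a)" for C
      using that \<C> unfolding layer_eq_step_sizes[OF \<C> a]
      by (intro card_initial_segments) (auto simp: multichains_def)
    \<comment> \<open>The factorials are naturals on the left, as in the count, and reals on the
      right, as in \<open>multinomial\<close>.\<close>
    moreover have "real (prod_list (map fact a)) = prod_list (map fact a)"
      by (induction a) auto
    ultimately show ?thesis by (simp add: multinomial_def)
  qed
  then have "(\<Sum>a \<in> compositions n (r + 1). real (card (layer \<C> (butlast a))) / multinomial n a)
      = (\<Sum>a \<in> compositions n (r + 1). \<Sum>C \<in> layer \<C> (butlast a). ?w C / fact n)"
    by (intro sum.cong) simp_all
  also have "\<dots> = (\<Sum>C \<in> \<C>. ?w C / fact n)" by (rule layers_partition[OF \<C>])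
  also have "\<dots> = real (\<Sum>C \<in> \<C>. ?w C) / fact n" by (simp add: sum_divide_distrib)
  also have "(\<Sum>C \<in> \<C>. ?w C) = (\<Sum>xs \<in> ?Perms. card {C \<in> \<C>. initial_segments xs C})"
    using sum_multicount_gen[of \<C> ?Perms "\<lambda>C xs. initial_segments xs C"] fin by simp
  also have "real \<dots> / fact n \<le> real (\<Sum>xs \<in> ?Perms. N) / fact n"
    using le by (intro divide_right_mono of_nat_mono sum_mono) auto
  also have "\<dots> = N" by simp
  finally show ?thesis .
qed

section \<open>Initial segments of a single order\<close>

text \<open>Prefixes of one list are nested, so \<open>t + 1\<close> of them in the family would
  form a forbidden chain.\<close>

lemma card_initial_segments_component:
  assumes "chain_free t \<A>"
  shows "finite {X \<in> \<A>. set (take (card X) xs) = X}" (is "finite ?F")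
    and "card {X \<in> \<A>. set (take (card X) xs) = X} \<le> t"
proof -
  have "?F \<subseteq> Pow (set xs)" using set_take_subset by fastforce
  then show "finite ?F" by (rule finite_subset) simp
  show "card ?F \<le> t"
  proof (rule ccontr)
    assume "\<not> card ?F \<le> t"
    then have "t + 1 \<le> card ?F" by linarith
    then obtain K where K: "K \<subseteq> ?F" "card K = t + 1"
      by (rule obtain_subset_with_card_n)
    have "X \<subseteq> Y \<or> Y \<subseteq> X" if "X \<in> K" "Y \<in> K" for X Y
    proof -
      have "set (take (card X) xs) = X" "set (take (card Y) xs) = Y" using that K(1) by blast+
      then show ?thesis by (metis nat_le_linear set_take_subset_set_take)
    qed
    then have "chain\<^sub>\<subseteq> K" by (auto simp: chain_subset_def)
    moreover have "K \<subseteq> \<A>" using K(1) by blast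
    ultimately show False using K(2) assms unfolding chain_free_def by blast
  qed
qed

text \<open>A multichain is determined by its components, so those made of initial segments embed
  into the product of the sets of initial segments lying in each component.\<close>

lemma card_initial_segments_family:
  assumes "\<C> \<subseteq> multichains n r" "\<forall>k \<in> {1..r}. chain_free (t k) (component \<C> k)"
  shows "card {C \<in> \<C>. initial_segments xs C} \<le> (\<Prod>k = 1..r. t k)"
proof -
  let ?F = "\<lambda>k. {X \<in> component \<C> k. set (take (card X) xs) = X}"
  \<comment> \<open>Restricting to \<open>{1..r}\<close> makes the function extensional, so that it
    can lie in the \<open>PiE\<close> product.\<close>
  let ?g = "\<lambda>C. \<lambda>k \<in> {1..r}. C ! (k - 1)"
  have fin: "finite (?F k)" if "k \<in> {1..r}" for k
    using assms(2) that by (intro card_initial_segments_component(1)) (rule bspec)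
  have len: "length C = r" if "C \<in> \<C>" for C using that assms by (auto simp: multichains_def)
  have "inj_on ?g \<C>"
  proof (rule inj_onI)
    fix C D assume CD: "C \<in> \<C>" "D \<in> \<C>" "?g C = ?g D"
    have "C ! i = D ! i" if "i < r" for i
      using fun_cong[OF CD(3), of "Suc i"] that by simp
    then show "C = D" using len CD by (intro nth_equalityI) auto
  qed
  then have "inj_on ?g {C \<in> \<C>. initial_segments xs C}" by (rule inj_on_subset) auto
  moreover have "?g ` {C \<in> \<C>. initial_segments xs C} \<subseteq> (\<Pi>\<^sub>E k \<in> {1..r}. ?F k)"
    using len by (fastforce simp: component_def initial_segments_def)
  ultimately have "card {C \<in> \<C>. initial_segments xs C} \<le> card (\<Pi>\<^sub>E k \<in> {1..r}. ?F k)"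
    using fin by (intro card_inj_on_le[of ?g] finite_PiE) simp_all
  also have "\<dots> = (\<Prod>k = 1..r. card (?F k))" by (simp add: card_PiE)
  also have "\<dots> \<le> (\<Prod>k = 1..r. t k)"
  proof (intro prod_mono conjI)
    fix k assume "k \<in> {1..r}"
    then show "card (?F k) \<le> t k"
      using assms(2) by (intro card_initial_segments_component(2)) (rule bspec)
  qed simp
  finally show ?thesis .
qed

text \<open>Members of one layer agree in size at every position, and an order has at most one
  initial segment of each size. Hence each order admits at most one member, and double counting
  applies with bound 1.\<close>

lemma card_layer_le_multinomial:
  assumes \<C>: "\<C> \<subseteq> multichains n r" and a: "a \<in> compositions n (r + 1)"
  shows "real (card (layer \<C> (butlast a))) / multinomial n a \<le> 1"
proof -
  define \<D> where "\<D> = layer \<C> (butlast a)"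
  have \<D>: "\<D> \<subseteq> multichains n r" using \<C> by (auto simp: \<D>_def layer_def)
  have "card {C \<in> \<D>. initial_segments xs C} \<le> 1" for xs
  proof -
    have "C = D" if "C \<in> \<D>" "D \<in> \<D>" "initial_segments xs C" "initial_segments xs D" for C D
    proof (rule nth_equalityI)
      show len: "length C = length D" using that \<D> by (auto simp: multichains_def)
      fix i assume i: "i < length C"
      then have "card (C ! i) = card (D ! i)"
        using that(1,2) len layer_eq_step_sizes[OF \<C> a] by (auto simp: \<D>_def step_sizes_def)
      then show "C ! i = D ! i" using that(3,4) i len
        by (metis initial_segments_def nth_mem)
    qed
    then show ?thesis
      by (intro card_le_Suc0_iff_eq[THEN iffD2, folded One_nat_def])
        (auto intro: finite_subset[OF _ finite_subset[OF \<D> finite_multichains]])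
  qed
  then have "(\<Sum>b \<in> compositions n (r + 1). real (card (layer \<D> (butlast b))) / multinomial n b)
      \<le> real 1"
    by (rule sum_layers_le[OF \<D>])
  \<comment> \<open>The bound covers a sum over all compositions; nonnegativity lets the term at
    \<open>a\<close> be singled out.\<close>
  moreover have "real (card (layer \<D> (butlast a))) / multinomial n a
      \<le> (\<Sum>b \<in> compositions n (r + 1). real (card (layer \<D> (butlast b))) / multinomial n b)"
    using a by (intro member_le_sum finite_compositions) (simp_all add: multinomial_pos less_imp_le)
  moreover have "layer \<D> (butlast a) = \<D>" by (auto simp: \<D>_def layer_def)
  ultimately show ?thesis by (simp add: \<D>_def)
qed

section \<open>From bounded weights to the largest coefficients\<close>

lemma weighted_sum_le_largest:
  fixes g x :: "nat \<Rightarrow> real"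
  assumes anti: "\<And>i j. i \<le> j \<Longrightarrow> j < m \<Longrightarrow> g j \<le> g i" and nonneg: "\<And>i. i < m \<Longrightarrow> 0 \<le> g i"
    and x: "\<And>i. i < m \<Longrightarrow> 0 \<le> x i \<and> x i \<le> 1" and "(\<Sum>i<m. x i) \<le> real \<tau>"
  shows "(\<Sum>i<m. x i * g i) \<le> (\<Sum>i<min \<tau> m. g i)"
proof (cases "\<tau> < m")
  case False
  have "(\<Sum>i<m. x i * g i) \<le> (\<Sum>i<m. g i)"
    using x nonneg by (intro sum_mono mult_left_le_one_le) auto
  then show ?thesis using False by simp
next
  case True
  \<comment> \<open>\<open>g \<tau>\<close>, the first value after the \<open>\<tau>\<close>
    largest, is the threshold: before it the difference is nonnegative and weight 1 is best, from it
    on the difference is nonpositive and weight 0 is best.\<close>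
  have "x i * (g i - g \<tau>) \<le> (if i < \<tau> then g i - g \<tau> else 0)" if "i < m" for i
  proof (cases "i < \<tau>")
    case True
    then show ?thesis using x[OF that] anti[of i \<tau>] \<open>\<tau> < m\<close>
      by (auto intro!: mult_left_le_one_le)
  next
    case False
    then show ?thesis using x[OF that] anti[of \<tau> i] that
      by (auto simp: mult_nonneg_nonpos)
  qed
  then have "(\<Sum>i<m. x i * (g i - g \<tau>)) \<le> (\<Sum>i<m. if i < \<tau> then g i - g \<tau> else 0)"
    by (intro sum_mono) auto
  also have "\<dots> = (\<Sum>i \<in> {..<m} \<inter> {i. i < \<tau>}. g i - g \<tau>)"
    by (simp add: sum.inter_restrict)
  also have "{..<m} \<inter> {i. i < \<tau>} = {..<\<tau>}" using True by auto
  \<comment> \<open>Adding the threshold back leaves an error term whose sign comes from the bound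
    on the total weight.\<close>
  finally have "(\<Sum>i<m. x i * g i) \<le> (\<Sum>i<\<tau>. g i) + ((\<Sum>i<m. x i) - real \<tau>) * g \<tau>"
    by (simp add: algebra_simps sum_subtractf sum_distrib_left)
  moreover have "((\<Sum>i<m. x i) - real \<tau>) * g \<tau> \<le> 0"
    using assms True by (intro mult_nonpos_nonneg) auto
  ultimately show ?thesis using True by simp
qed

text \<open>The \<open>min\<close> reflects that \<open>largest_multinomial\<close> is 0 past the
  end of the list.\<close>

lemma sum_largest_multinomial:
  "(\<Sum>i = 1..\<tau>. largest_multinomial n s i)
     = (\<Sum>i < min \<tau> (length (multinomials_desc n s)). multinomials_desc n s ! i)"
proof -
  let ?L = "multinomials_desc n s"
  have "(\<Sum>i = 1..\<tau>. largest_multinomial n s i) = (\<Sum>i<\<tau>. largest_multinomial n s (Suc i))"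
    by (metis One_nat_def sum.atLeast1_atMost_eq)
  also have "\<dots> = (\<Sum>i<\<tau>. if i \<in> {..<length ?L} then ?L ! i else 0)"
    by (intro sum.cong) (auto simp: largest_multinomial_def)
  also have "\<dots> = (\<Sum>i \<in> {..<\<tau>} \<inter> {..<length ?L}. ?L ! i)"
    by (simp only: sum.inter_restrict finite_lessThan)
  also have "{..<\<tau>} \<inter> {..<length ?L} = {..<min \<tau> (length ?L)}" by auto
  finally show ?thesis .
qed

text \<open>Weights belong to compositions, while the list holds only values. Sorting the
  compositions by coefficient assigns each position its own composition, even among equal
  values.\<close>

lemma multinomials_desc_enum:
  obtains as where "distinct as" "set as = compositions n s"
    "multinomials_desc n s = map (multinomial n) as"
proof -
  obtain l where l: "set l = compositions n s" "distinct l"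
    using finite_distinct_list[OF finite_compositions] by blast
  have "mset_set (compositions n s) = mset l"
    using mset_set_set[OF l(2)] l(1) by simp
  then have "multinomials_desc n s = rev (sort (map (multinomial n) l))"
    unfolding multinomials_desc_def
    by (simp flip: mset_map)
  also have "sort (map (multinomial n) l) = map (multinomial n) (sort_key (multinomial n) l)"
    by (rule properties_for_sort) simp_all
  finally show ?thesis
    using that[of "rev (sort_key (multinomial n) l)"] l by (simp add: rev_map)
qed

lemma weighted_multinomials_le_largest:
  assumes "\<And>a. a \<in> compositions n s \<Longrightarrow> 0 \<le> x a \<and> x a \<le> 1"
    and "(\<Sum>a \<in> compositions n s. x a) \<le> real \<tau>"
  shows "(\<Sum>a \<in> compositions n s. x a * multinomial n a)
           \<le> (\<Sum>i = 1..\<tau>. largest_multinomial n s i)"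
proof -
  let ?L = "multinomials_desc n s"
  obtain as where as: "distinct as" "set as = compositions n s" "?L = map (multinomial n) as"
    by (rule multinomials_desc_enum)
  \<comment> \<open>Moves sums over compositions to positions in the descending list.\<close>
  have sum_as: "(\<Sum>a \<in> compositions n s. h a) = (\<Sum>i<length as. h (as ! i))" for h :: "nat list \<Rightarrow> real"
    using sum.reindex_bij_betw[OF bij_betw_nth[OF as(1) refl as(2)[symmetric]], of h] by simp
  have desc: "sorted_wrt (\<ge>) ?L"
    by (simp add: multinomials_desc_def sorted_wrt_rev)
  have "(\<Sum>i<length as. x (as ! i) * ?L ! i) \<le> (\<Sum>i < min \<tau> (length as). ?L ! i)"
  proof (rule weighted_sum_le_largest)
    show "?L ! j \<le> ?L ! i" if "i \<le> j" "j < length as" for i j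
      using that as(3) sorted_wrt_nth_less[OF desc, of i j] by (cases "i = j") auto
    show "0 \<le> ?L ! i" if "i < length as" for i
      using that as(3) by (simp add: multinomial_pos less_imp_le)
    show "0 \<le> x (as ! i) \<and> x (as ! i) \<le> 1" if "i < length as" for i
      using that as(2) assms(1) nth_mem by metis
    show "(\<Sum>i<length as. x (as ! i)) \<le> real \<tau>" using assms(2) by (simp add: sum_as)
  qed
  then show ?thesis unfolding sum_as sum_largest_multinomial by (simp add: as(3))
qed

theorem theorem3p4:
  fixes n r :: nat and t :: "nat \<Rightarrow> nat" and \<C> :: "nat set list set"
  assumes "n \<ge> 1" and "r \<ge> 1"
    and "\<forall>k \<in> {1..r}. t k \<ge> 1"
    and "\<C> \<subseteq> multichains n r"
    and "\<forall>k \<in> {1..r}. chain_free (t k) (component \<C> k)"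
  shows "(\<Sum>a \<in> compositions n (r + 1). real (card (layer \<C> (butlast a))) / multinomial n a)
           \<le> real (\<Prod>k = 1..r. t k)
         \<and> real (card \<C>) \<le> (\<Sum>i = 1..(\<Prod>k = 1..r. t k). largest_multinomial n (r + 1) i)"
proof
  let ?x = "\<lambda>a. real (card (layer \<C> (butlast a))) / multinomial n a"
  let ?\<tau> = "\<Prod>k = 1..r. t k"
  show total: "(\<Sum>a \<in> compositions n (r + 1). ?x a) \<le> real ?\<tau>"
    using assms by (intro sum_layers_le card_initial_segments_family)
  have "real (card \<C>) = (\<Sum>a \<in> compositions n (r + 1). \<Sum>C \<in> layer \<C> (butlast a). 1)"
    by (simp only: layers_partition[OF assms(4)]) simp
  also have "\<dots> = (\<Sum>a \<in> compositions n (r + 1). ?x a * multinomial n a)"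
    using multinomial_pos[THEN less_imp_neq, THEN not_sym] by (intro sum.cong) simp_all
  \<comment> \<open>The normalised layer sizes act as weights:
    \<open>card_layer_le_multinomial\<close> caps each at 1, and \<open>total\<close> bounds their
    sum.\<close>
  also have "\<dots> \<le> (\<Sum>i = 1..?\<tau>. largest_multinomial n (r + 1) i)"
    using total card_layer_le_multinomial[OF assms(4)]
    by (intro weighted_multinomials_le_largest) (simp_all add: multinomial_pos less_imp_le)
  finally show "real (card \<C>) \<le> (\<Sum>i = 1..?\<tau>. largest_multinomial n (r + 1) i)" .
qed

end
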